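(* Let $H=(V,E)$ be a $3$-uniform hypergraph with $n$ vertices. Then $\mathrm{pmd}(H)\leq \frac{3}{2}n^2-\frac{15}{2}n+10$.
   Context: A hypergraph $H=(V,E)$ consists of a finite vertex set $V$ and a set $E$ of subsets of $V$ (edges); it is $r$-uniform if $|e|=r$ for all $e\in E$. A matching is a subset $M\subseteq E$ with $e\cap e'=\emptyset$ for all $e\ne e'$ in $M$. A positive matching of $(V,E)$ is a matching $M\subseteq E$ for which there is $w:V\to\mathbb{Q}$ with $\sum_{i\in e}w(i)>0$ for $e\in M$ and $\sum_{i\in e}w(i)<0$ for $e\in E\setminus M$. A positive matching decomposition of $H$ is a partition $E=\bigcup_{i=1}^pM_i$ into pairwise disjoint subsets such that $M_i$ is a positive matching on $(V,E\setminus\bigcup_{j=1}^{i-1}M_j)$ for $i=1,\dots,p$. The smallest such $p$ is denoted $\mathrm{pmd}(H)$. *)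

theory Defs
  imports Complex_Main
begin

definition hypergraph :: "'a set \<Rightarrow> 'a set set \<Rightarrow> bool" where
  "hypergraph V E \<longleftrightarrow> finite V \<and> E \<subseteq> Pow V"

definition uniform_edges :: "nat \<Rightarrow> 'a set set \<Rightarrow> bool" where
  "uniform_edges r E \<longleftrightarrow> (\<forall>e\<in>E. card e = r)"

definition matching :: "'a set set \<Rightarrow> 'a set set \<Rightarrow> bool" where
  "matching E M \<longleftrightarrow> M \<subseteq> E \<and> pairwise disjnt M"

(* The vertex set is not a parameter here or below: all edges of a hypergraph lie
   in it, so the values of w at points outside it play no role. *)
definition positive_matching :: "'a set set \<Rightarrow> 'a set set \<Rightarrow> bool" where
  "positive_matching E M \<longleftrightarrow> matching E M \<and>
     (\<exists>w :: 'a \<Rightarrow> rat. (\<forall>e\<in>M. (\<Sum>i\<in>e. w i) > 0) \<and> (\<forall>e\<in>E - M. (\<Sum>i\<in>e. w i) < 0))"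

(* Parts may be empty. This does not affect the least number of parts, since an
   empty part can be dropped. The edgeless hypergraph has a decomposition with p = 0. *)
definition positive_matching_decomposition ::
    "'a set set \<Rightarrow> nat \<Rightarrow> (nat \<Rightarrow> 'a set set) \<Rightarrow> bool" where
  "positive_matching_decomposition E p M \<longleftrightarrow>
     E = (\<Union>i\<in>{1..p}. M i) \<and>
     (\<forall>i\<in>{1..p}. \<forall>j\<in>{1..p}. i \<noteq> j \<longrightarrow> M i \<inter> M j = {}) \<and>
     (\<forall>i\<in>{1..p}. positive_matching (E - (\<Union>j\<in>{1..<i}. M j)) (M i))"

(* LEAST is an unspecified number if there is no decomposition at all. For an
   r-uniform hypergraph with r > 0 there always is one, with single edges as parts. *)
definition pmd :: "'a set set \<Rightarrow> nat" where
  "pmd E = (LEAST p. \<exists>M. positive_matching_decomposition E p M)"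

end

theory Submission imports Defs begin

text \<open>
  Label the vertices by $0, \dots, n-1$ and write an edge as $a < b < c$. Edges are put in the same
  part when they agree in the two sums $a + b$ and $b + c$, that is, when they lie on a common line
  $(a - t, b + t, c - t)$. Along such a line the outer labels decrease while the middle one
  increases, so the order $a < b < c$ prevents two of its edges from meeting; hence each part is
  a matching (\<open>same_pair_sums_disjnt\<close>).

  The parts are removed in the order of increasing span $c - a$, ties being broken by decreasing
  $a + 2b + c$; the single integer $N (c - a) - (a + 2b + c)$ with large $N$ encodes this order.
  The weight that isolates a part is a concave function of the label, the minimum of three affine
  functions with slopes $N + 1$, $2$ and $1 - N$. Bounding the weight of $a$, $b$, $c$ by the first,
  second and third of them, respectively, shows that an edge weighs at most a constant minus its
  place in the order (\<open>tent_sum_le\<close>), so all later edges are negative. If the breakpoints are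
  $(a + b) / 2$ and $(b + c) / 2$, the bound is attained by every edge of the part itself
  (\<open>tent_sum_eq\<close>).

  Finally, each line starts at a triple that cannot be moved to $(a + 1, b - 1, c + 1)$, so with
  $b = a + 1$, $b = a + 2$ or $c = n - 1$. The number of such triples is
  $\binom{n-1}{2} + \binom{n-2}{2} + \binom{n-3}{2}$ (\<open>card_pair_sums_le\<close>), which is the asserted
  bound when $n \geq 3$.
\<close>

section \<open>Decompositions from a ranking of the edges\<close>

text \<open>
  The level sets of the ranking, in increasing order, are the parts: what is left when a
  level is treated consists of this level and the higher ones.
\<close>

lemma pmd_le_card_ranks:
  fixes rank :: "'a set \<Rightarrow> 'k::linorder"
  assumes fin: "finite E"
    and disj: "\<And>e e'. \<lbrakk>e \<in> E; e' \<in> E; rank e = rank e'; e \<noteq> e'\<rbrakk> \<Longrightarrow> disjnt e e'"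
    and weight: "\<And>d. d \<in> E \<Longrightarrow> \<exists>w :: 'a \<Rightarrow> rat. \<forall>e\<in>E.
        (rank e = rank d \<longrightarrow> sum w e > 0) \<and> (rank d < rank e \<longrightarrow> sum w e < 0)"
  shows "pmd E \<le> card (rank ` E)"
proof -
  define ks where "ks = sorted_list_of_set (rank ` E)"
  define p where "p = card (rank ` E)"
  define M where "M i = {e \<in> E. rank e = ks ! (i - 1)}" for i
  have ks: "set ks = rank ` E" "length ks = p" "sorted ks" "distinct ks"
    using fin by (simp_all add: ks_def p_def)
  have ks_less: "ks ! i < ks ! j" if "i < j" "j < p" for i j
    using that ks by (meson sorted_wrt_nth_less strict_sorted_iff)
  have index: "\<exists>i\<in>{1..p}. ks ! (i - 1) = rank e" if "e \<in> E" for e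
  proof -
    have "rank e \<in> set ks" using that ks by simp
    then obtain i where "i < p" "ks ! i = rank e"
      using ks(2) by (auto simp: in_set_conv_nth)
    then show ?thesis by (intro bexI[of _ "Suc i"]) auto
  qed
  have "positive_matching_decomposition E p M"
    unfolding positive_matching_decomposition_def
  proof (intro conjI ballI impI)
    show "E = (\<Union>i\<in>{1..p}. M i)"
      using index by (fastforce simp: M_def)
  next
    fix i j assume ij: "i \<in> {1..p}" "j \<in> {1..p}" "i \<noteq> j"
    then have "i - 1 \<noteq> j - 1" "i - 1 < p" "j - 1 < p" by auto
    then have "ks ! (i - 1) \<noteq> ks ! (j - 1)"
      using ks by (simp add: nth_eq_iff_index_eq)
    then show "M i \<inter> M j = {}" by (auto simp: M_def)
  next
    fix i assume i: "i \<in> {1..p}"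
    let ?R = "E - (\<Union>j\<in>{1..<i}. M j)"
    have "ks ! (i - 1) \<in> set ks" using i ks(2) by auto
    then obtain d where d: "d \<in> E" "rank d = ks ! (i - 1)" using ks by auto
    obtain w :: "'a \<Rightarrow> rat" where w: "\<forall>e\<in>E.
        (rank e = rank d \<longrightarrow> sum w e > 0) \<and> (rank d < rank e \<longrightarrow> sum w e < 0)"
      using weight[OF d(1)] by blast
    have "rank d < rank e" if e: "e \<in> ?R - M i" for e
    proof -
      obtain k where k: "k \<in> {1..p}" "ks ! (k - 1) = rank e" using index e by blast
      have "e \<in> M k" using e k by (simp add: M_def)
      then have "k \<notin> {1..<i}" "k \<noteq> i" using e by auto
      then have "i - 1 < k - 1" "k - 1 < p" using k i by auto
      then show ?thesis using ks_less d k by metis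
    qed
    then have neg: "\<forall>e\<in>?R - M i. sum w e < 0" using w by blast
    have pos: "\<forall>e\<in>M i. sum w e > 0" using w d by (auto simp: M_def)
    have "M j \<inter> M i = {}" if "j \<in> {1..<i}" for j
    proof -
      have "ks ! (j - 1) < ks ! (i - 1)" using that i by (intro ks_less) auto
      then show ?thesis by (auto simp: M_def)
    qed
    then have "M i \<subseteq> ?R" by (fastforce simp: M_def)
    moreover have "pairwise disjnt (M i)"
      using disj by (auto simp: pairwise_def M_def)
    ultimately show "positive_matching ?R (M i)"
      using pos neg unfolding positive_matching_def matching_def by blast
  qed
  then show ?thesis unfolding pmd_def p_def by (auto intro: Least_le)
qed

section \<open>The concave weight\<close>

text \<open>
  The part with pair sums $x = a + b$ and $y = b + c$ receives this weight. The breakpoints are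
  $x/2$ and $y/2$, which separate $a$ from $b$ and $b$ from $c$ for all edges of the part. The
  additive constant is the one for which these edges get total weight $1/2$. This is
  positive, and it leaves every later edge negative, because ranks are integers and so
  differ by at least $1$.
\<close>

definition tent :: "rat \<Rightarrow> rat \<Rightarrow> rat \<Rightarrow> rat \<Rightarrow> rat" where
  "tent N x y i = 2 * i + (N * (y - x) - 3 * (x + y) + 1) / 6
     + min 0 (min ((N - 1) * (i - x / 2)) (- (N + 1) * (i - y / 2)))"

definition rank_of :: "'a::comm_ring \<Rightarrow> 'a \<Rightarrow> 'a \<Rightarrow> 'a" where
  "rank_of N x y = N * (y - x) - (x + y)"

text \<open>
  The minimum in the weight is bounded at $a$ by its increasing branch, at $b$ by $0$
  and at $c$ by its decreasing branch.
\<close>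

lemma tent_sum_le:
  "tent N x y a + tent N x y b + tent N x y c
     \<le> rank_of N x y - rank_of N (a + b) (b + c) + 1 / 2"
proof -
  let ?m = "\<lambda>i. min 0 (min ((N - 1) * (i - x / 2)) (- (N + 1) * (i - y / 2)))"
  have "?m a + ?m b + ?m c \<le> (N - 1) * (a - x / 2) + 0 + (- (N + 1) * (c - y / 2))"
    by (intro add_mono) auto
  then show ?thesis
    unfolding tent_def rank_of_def by (simp add: field_simps)
qed

lemma tent_sum_eq:
  assumes "N \<ge> 1" "a \<le> b" "b \<le> c"
  shows "tent N (a + b) (b + c) a + tent N (a + b) (b + c) b + tent N (a + b) (b + c) c = 1 / 2"
proof -
  let ?x = "a + b" and ?y = "b + c"
  let ?m = "\<lambda>i. min 0 (min ((N - 1) * (i - ?x / 2)) (- (N + 1) * (i - ?y / 2)))"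
  have up: "0 \<le> (N - 1) * (i - ?x / 2)" if "?x / 2 \<le> i" for i
    using that assms(1) by simp
  have up': "(N - 1) * (i - ?x / 2) \<le> 0" if "i \<le> ?x / 2" for i
    using that assms(1) by (intro mult_nonneg_nonpos) auto
  have down: "- (N + 1) * (i - ?y / 2) \<le> 0" if "?y / 2 \<le> i" for i
    using that assms(1) by (intro mult_nonpos_nonneg) auto
  have down': "0 \<le> - (N + 1) * (i - ?y / 2)" if "i \<le> ?y / 2" for i
    using that assms(1) by (intro mult_nonpos_nonpos) auto
  have "?m a = (N - 1) * (a - ?x / 2)"
    using up'[of a] down'[of a] assms by (simp add: min.absorb1 min.absorb2)
  moreover have "?m b = 0"
    using up[of b] down'[of b] assms by (simp add: min.absorb1)
  moreover have "?m c = - (N + 1) * (c - ?y / 2)"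
    using order_trans[OF down[of c] up[of c]] down[of c] assms by (simp add: min.absorb2)
  ultimately show ?thesis
    unfolding tent_def by (simp only:) (simp add: field_simps)
qed

text \<open>
  For large \<open>N\<close> the rank is a lexicographic order, so it determines both pair sums.
\<close>

lemma rank_of_inj:
  fixes x y x' y' N :: int
  assumes "rank_of N x y = rank_of N x' y'"
    and "0 \<le> x + y" "x + y < N" "0 \<le> x' + y'" "x' + y' < N"
  shows "x = x' \<and> y = y'"
proof -
  let ?k = "(y - x) - (y' - x')"
  have eq: "N * ?k = (x + y) - (x' + y')"
    using assms(1) by (simp add: rank_of_def algebra_simps)
  then have "\<bar>N * ?k\<bar> < N" using assms(2-5) by linarith
  then have "N * \<bar>?k\<bar> < N * 1" using assms(2,3) by (simp add: abs_mult)
  moreover have "0 < N" using assms(2,3) by linarith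
  ultimately have "\<bar>?k\<bar> < 1" by (simp only: mult_less_cancel_left_pos)
  then have "?k = 0" by linarith
  with eq show ?thesis by simp
qed

section \<open>Labelled triples\<close>

text \<open>
  For an edge with labels $a < b < c$ these are $a + b$ and $b + c$, written without a choice of
  names for its vertices.
\<close>

definition low_sum :: "('a \<Rightarrow> nat) \<Rightarrow> 'a set \<Rightarrow> nat" where
  "low_sum f e = sum f e - Max (f ` e)"

definition high_sum :: "('a \<Rightarrow> nat) \<Rightarrow> 'a set \<Rightarrow> nat" where
  "high_sum f e = sum f e - Min (f ` e)"

lemma sorted_triple:
  fixes f :: "'a \<Rightarrow> nat"
  assumes "card e = 3" "inj_on f e"
  obtains p q r where "e = {p, q, r}" "f p < f q" "f q < f r"
    "low_sum f e = f p + f q" "high_sum f e = f q + f r" "\<And>w. sum w e = w p + w q + (w r :: rat)"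
proof -
  obtain u v z where e: "e = {u, v, z}" "u \<noteq> v" "v \<noteq> z" "u \<noteq> z"
    using assms(1) by (auto simp: card_3_iff)
  have "f u \<noteq> f v" "f v \<noteq> f z" "f u \<noteq> f z"
    using assms(2) e by (auto simp: inj_on_def)
  then have "f u < f v \<and> f v < f z \<or> f u < f z \<and> f z < f v \<or> f v < f u \<and> f u < f z \<or>
      f v < f z \<and> f z < f u \<or> f z < f u \<and> f u < f v \<or> f z < f v \<and> f v < f u"
    by linarith
  then have "\<exists>p q r. e = {p, q, r} \<and> f p < f q \<and> f q < f r"
    unfolding e(1) by (elim disjE) (blast intro: insert_commute)+
  then obtain p q r where pqr: "e = {p, q, r}" "f p < f q" "f q < f r" by blast
  then have "p \<noteq> q" "q \<noteq> r" "p \<noteq> r" by auto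
  moreover from this have "sum f e = f p + f q + f r" "Max (f ` e) = f r" "Min (f ` e) = f p"
    using pqr by (simp_all add: max_def min_def)
  ultimately show ?thesis
    using pqr by (intro that[of p q r]) (simp_all add: low_sum_def high_sum_def)
qed

text \<open>
  A common vertex forces equal labels: two edges of a part differ by $(-t, t, -t)$, and if, say,
  $t > 0$, all six labels are distinct because
  $a - t < a < b < b + t < c - t < c$.
\<close>

lemma same_pair_sums_disjnt:
  assumes "inj_on f (e \<union> e')" "card e = 3" "card e' = 3" "e \<noteq> e'"
    and "low_sum f e = low_sum f e'" "high_sum f e = high_sum f e'"
  shows "disjnt e e'"
proof (rule ccontr)
  assume "\<not> disjnt e e'"
  then obtain v where v: "v \<in> e" "v \<in> e'" by (auto simp: disjnt_def)
  have inj: "inj_on f e" "inj_on f e'"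
    using assms(1) by (auto simp: inj_on_Un)
  obtain p q r where e: "e = {p, q, r}" "f p < f q" "f q < f r"
      "low_sum f e = f p + f q" "high_sum f e = f q + f r"
    using assms(2) inj(1) by (elim sorted_triple)
  obtain p' q' r' where e': "e' = {p', q', r'}" "f p' < f q'" "f q' < f r'"
      "low_sum f e' = f p' + f q'" "high_sum f e' = f q' + f r'"
    using assms(3) inj(2) by (elim sorted_triple)
  have sums: "f p + f q = f p' + f q'" "f q + f r = f q' + f r'"
    using assms(5,6) e e' by simp_all
  have "f v \<in> {f p, f q, f r}" "f v \<in> {f p', f q', f r'}" using v e e' by auto
  then have "f q = f q'"
    using sums e(2,3) e'(2,3) by (elim insertE emptyE; linarith)
  then have "f p = f p'" "f q = f q'" "f r = f r'" using sums by auto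
  then have "f ` e = f ` e'" using e(1) e'(1) by simp
  then show False
    using assms(1,4) by (simp add: inj_on_Un_image_eq_iff)
qed

section \<open>Counting the parts\<close>

definition increasing_pairs :: "nat \<Rightarrow> (nat \<times> nat) set" where
  "increasing_pairs m = {(i, j). i < j \<and> j < m}"

lemma finite_increasing_pairs: "finite (increasing_pairs m)"
  by (rule finite_subset[of _ "{..<m} \<times> {..<m}"]) (auto simp: increasing_pairs_def)

lemma card_increasing_pairs: "2 * card (increasing_pairs m) = m * (m - 1)"
proof (induction m)
  case 0
  then show ?case by (simp add: increasing_pairs_def)
next
  case (Suc m)
  have "increasing_pairs (Suc m) = increasing_pairs m \<union> (\<lambda>i. (i, m)) ` {..<m}"
    by (auto simp: increasing_pairs_def less_Suc_eq)
  moreover have "increasing_pairs m \<inter> (\<lambda>i. (i, m)) ` {..<m} = {}"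
    by (auto simp: increasing_pairs_def)
  moreover have "card ((\<lambda>i. (i, m)) ` {..<m}) = m"
    by (simp add: card_image inj_on_def)
  ultimately have "card (increasing_pairs (Suc m)) = card (increasing_pairs m) + m"
    by (simp add: card_Un_disjoint finite_increasing_pairs)
  with Suc show ?case by (cases m) (simp_all add: algebra_simps)
qed

definition pair_sums :: "nat \<Rightarrow> (nat \<times> nat) set" where
  "pair_sums n = {(a + b, b + c) | a b c. a < b \<and> b < c \<and> c < n}"

text \<open>
  Each value is represented by the triple with the least middle entry. As this triple cannot be
  moved to $(a + 1, b - 1, c + 1)$, it is one of $(a, a + 1, c)$, $(a, a + 2, c)$, or $(a, b, n - 1)$
  with $b \geq a + 3$. Each of the three families is parametrized by increasing pairs.
\<close>

lemma pair_sums_subset: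
  "pair_sums n \<subseteq>
     (\<lambda>(i, j). (i + (i + 1), (i + 1) + (j + 1))) ` increasing_pairs (n - 1) \<union>
     (\<lambda>(i, j). (i + (i + 2), (i + 2) + (j + 2))) ` increasing_pairs (n - 2) \<union>
     (\<lambda>(i, j). (i + (j + 2), (j + 2) + (n - 1))) ` increasing_pairs (n - 3)"
  (is "_ \<subseteq> ?S1 \<union> ?S2 \<union> ?S3")
proof -
  have "(a + b, b + c) \<in> ?S1 \<union> ?S2 \<union> ?S3" if "a < b" "b < c" "c < n" for a b c
    using that
  proof (induction b arbitrary: a c)
    case 0
    then show ?case by simp
  next
    case (Suc b)
    consider "Suc b = a + 1" | "Suc b = a + 2" | "Suc b \<ge> a + 3" "c = n - 1"
      | "Suc b \<ge> a + 3" "c + 1 < n"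
      using Suc.prems by linarith
    then show ?case
    proof cases
      case 1
      then have "(a, c - 1) \<in> increasing_pairs (n - 1)"
        using Suc.prems by (auto simp: increasing_pairs_def)
      then have "(a + Suc b, Suc b + c) \<in> ?S1"
        using 1 Suc.prems by (intro image_eqI[of _ _ "(a, c - 1)"]) auto
      then show ?thesis by blast
    next
      case 2
      then have "(a, c - 2) \<in> increasing_pairs (n - 2)"
        using Suc.prems by (auto simp: increasing_pairs_def)
      then have "(a + Suc b, Suc b + c) \<in> ?S2"
        using 2 Suc.prems by (intro image_eqI[of _ _ "(a, c - 2)"]) auto
      then show ?thesis by blast
    next
      case 3
      then have "(a, b - 1) \<in> increasing_pairs (n - 3)"
        using Suc.prems by (auto simp: increasing_pairs_def)
      then have "(a + Suc b, Suc b + c) \<in> ?S3"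
        using 3 Suc.prems by (intro image_eqI[of _ _ "(a, b - 1)"]) auto
      then show ?thesis by blast
    next
      case 4
      then have "((a + 1) + b, b + (c + 1)) \<in> ?S1 \<union> ?S2 \<union> ?S3"
        using Suc.prems by (intro Suc.IH) auto
      then show ?thesis by simp
    qed
  qed
  then show ?thesis unfolding pair_sums_def by blast
qed

lemma card_pair_sums_le:
  "card (pair_sums n) \<le> card (increasing_pairs (n - 1)) + card (increasing_pairs (n - 2))
     + card (increasing_pairs (n - 3))"
proof -
  note fin = finite_imageI[OF finite_increasing_pairs]
  show ?thesis
    by (rule order_trans[OF card_mono[OF _ pair_sums_subset]],
        (intro finite_UnI fin)[1],
        intro order_trans[OF card_Un_le] add_mono card_image_le finite_increasing_pairs)
qed

lemma finite_pair_sums: "finite (pair_sums n)"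
  by (rule finite_subset[OF pair_sums_subset]) (intro finite_UnI finite_imageI finite_increasing_pairs)

text \<open>
  For $n < 3$ truncated subtraction makes the three families empty, whereas the polynomial is
  positive at $0$, $1$ and $2$.
\<close>

lemma card_pair_sums_bound:
  "real (card (pair_sums n)) \<le> 3 / 2 * real n ^ 2 - 15 / 2 * real n + 10"
proof -
  have pairs: "real (card (increasing_pairs m)) = real (m * (m - 1)) / 2" for m
    using arg_cong[OF card_increasing_pairs[of m], of real] by simp
  have "real (card (pair_sums n))
      \<le> real ((n - 1) * (n - 1 - 1)) / 2 + real ((n - 2) * (n - 2 - 1)) / 2
        + real ((n - 3) * (n - 3 - 1)) / 2"
    using card_pair_sums_le[of n] unfolding pairs[symmetric] by linarith
  also have "\<dots> \<le> 3 / 2 * real n ^ 2 - 15 / 2 * real n + 10"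
  proof -
    have "n = 0 \<or> n = 1 \<or> n = 2 \<or> n = 3 \<or> n = (n - 4) + 4" by linarith
    then consider "n = 0" | "n = 1" | "n = 2" | "n = 3" | k where "n = k + 4" by blast
    then show ?thesis
      by cases (simp_all add: power2_eq_square field_simps)
  qed
  finally show ?thesis .
qed

section \<open>Three-uniform hypergraphs\<close>

theorem theorem1p3:
  fixes V :: "'a set" and E :: "'a set set" and n :: nat
  assumes "hypergraph V E" and "uniform_edges 3 E" and "card V = n"
  shows "real (pmd E) \<le> 3 / 2 * real n ^ 2 - 15 / 2 * real n + 10"
proof -
  have V: "finite V" "E \<subseteq> Pow V" and card3: "\<And>e. e \<in> E \<Longrightarrow> card e = 3"
    using assms by (auto simp: hypergraph_def uniform_edges_def)
  have finE: "finite E" using V finite_subset by auto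
  obtain f where "bij_betw f V {0..<n}"
    using ex_bij_betw_finite_nat[OF V(1)] assms(3) by blast
  then have injV: "inj_on f V" and f_less: "\<And>v. v \<in> V \<Longrightarrow> f v < n"
    by (auto simp: bij_betw_def)
  have inj: "inj_on f e" if "e \<in> E" for e
    using injV V that by (auto intro: inj_on_subset)
  \<comment> \<open>exceeds the sum of the two pair sums of any edge, which makes the rank lexicographic\<close>
  define N :: int where "N = 4 * int n + 1"
  define rank where "rank e = rank_of N (int (low_sum f e)) (int (high_sum f e))" for e
  have sums: "(low_sum f e, high_sum f e) \<in> pair_sums n" if e: "e \<in> E" for e
  proof -
    obtain p q r where "e = {p, q, r}" "f p < f q" "f q < f r"
        "low_sum f e = f p + f q" "high_sum f e = f q + f r"
      using card3[OF e] inj[OF e] by (elim sorted_triple)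
    moreover from this have "f r < n" using V e f_less by auto
    ultimately show ?thesis unfolding pair_sums_def by blast
  qed
  have small: "low_sum f e + high_sum f e < 4 * n" if "e \<in> E" for e
    using sums[OF that] by (auto simp: pair_sums_def)
  have same_rank: "low_sum f e = low_sum f e' \<and> high_sum f e = high_sum f e'"
    if "e \<in> E" "e' \<in> E" "rank e = rank e'" for e e'
    using rank_of_inj[OF that(3)[unfolded rank_def]] small[OF that(1)] small[OF that(2)]
    by (simp add: N_def)
  have "pmd E \<le> card (rank ` E)"
  proof (rule pmd_le_card_ranks[OF finE])
    fix e e' assume e: "e \<in> E" "e' \<in> E" "rank e = rank e'" "e \<noteq> e'"
    have "low_sum f e = low_sum f e'" "high_sum f e = high_sum f e'"
      using same_rank e(1-3) by blast+
    moreover have "inj_on f (e \<union> e')"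
      using V e by (intro inj_on_subset[OF injV]) auto
    ultimately show "disjnt e e'"
      using card3 e by (intro same_pair_sums_disjnt) auto
  next
    fix d assume d: "d \<in> E"
    let ?t = "tent (of_int N) (of_nat (low_sum f d)) (of_nat (high_sum f d))"
    let ?w = "\<lambda>v. ?t (of_nat (f v))"
    have "(rank e = rank d \<longrightarrow> sum ?w e > 0) \<and> (rank d < rank e \<longrightarrow> sum ?w e < 0)"
      if e: "e \<in> E" for e
    proof -
      obtain p q r where pqr: "e = {p, q, r}" "f p < f q" "f q < f r"
          "low_sum f e = f p + f q" "high_sum f e = f q + f r"
          "\<And>w. sum w e = w p + w q + (w r :: rat)"
        by (rule sorted_triple[OF card3[OF e] inj[OF e]]) (rule that)
      have "sum ?w e > 0" if "rank e = rank d"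
      proof -
        have "low_sum f d = f p + f q" "high_sum f d = f q + f r"
          using same_rank[OF e d that] pqr by simp_all
        then show ?thesis
          using tent_sum_eq[of "of_int N" "of_nat (f p)" "of_nat (f q)" "of_nat (f r)"] pqr
          by (simp add: N_def)
      qed
      moreover have "sum ?w e < 0" if "rank d < rank e"
      proof -
        have rat_rank: "rank_of (of_int N) (of_nat x) (of_nat y)
            = (of_int (rank_of N (int x) (int y)) :: rat)" for x y
          by (simp add: rank_of_def)
        have "of_int (rank d) + (1 :: rat) \<le> of_int (rank e)"
          using that by (metis of_int_1 of_int_add of_int_le_iff zless_imp_add1_zle)
        moreover have "sum ?w e \<le> of_int (rank d) - of_int (rank e) + 1 / 2"
          using tent_sum_le[of "of_int N" _ _ "of_nat (f p)" "of_nat (f q)" "of_nat (f r)"]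
          unfolding pqr(6) rank_def rat_rank[symmetric] unfolding pqr(4,5) of_nat_add by blast
        ultimately show ?thesis by linarith
      qed
      ultimately show ?thesis by blast
    qed
    then show "\<exists>w :: 'a \<Rightarrow> rat. \<forall>e\<in>E.
        (rank e = rank d \<longrightarrow> sum w e > 0) \<and> (rank d < rank e \<longrightarrow> sum w e < 0)"
      by blast
  qed
  also have "rank ` E =
      (\<lambda>(x, y). rank_of N (int x) (int y)) ` (\<lambda>e. (low_sum f e, high_sum f e)) ` E"
    by (simp add: image_image rank_def)
  also have "card \<dots> \<le> card ((\<lambda>e. (low_sum f e, high_sum f e)) ` E)"
    using finE by (intro card_image_le) auto
  also have "\<dots> \<le> card (pair_sums n)"
    using sums by (intro card_mono finite_pair_sums) auto
  finally show ?thesis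
    using card_pair_sums_bound[of n] by linarith
qed

end
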